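(* Let $\mathcal{A}\in\mathbb{C}_{t}^{m,n}$ and let $\widetilde{\mathcal{A}}\in\mathbb{C}_{t}^{r,l}$ ($r\le m$, $l\le n$) be the subtensor of $\mathcal{A}$. Suppose the entries of $\mathcal{A}$ are all zero except for those of $\widetilde{\mathcal{A}}$. Then each tensor $\mathcal{G}\in\mathcal{A}\{1\}_k$ is a tensor in $\mathbb{C}_k^{n,m}$ whose subtensor $\widetilde{\mathcal{G}}\in\mathbb{C}_k^{l,r}$ belongs to $\widetilde{\mathcal{A}}\{1\}_k$ and all of whose other entries are arbitrary.
   Context: $[n]=\{1,\ldots,n\}$. $\mathbb{C}_{t}^{m,n}$ is the set of all order $t$ complex tensors $\mathcal{A}=(a_{i_1\cdots i_t})$ of dimension $m\times n\times\cdots\times n$ ($i_1\in[m]$, $i_2,\ldots,i_t\in[n]$). For $x\in\mathbb{C}^n$, $\mathcal{A}\cdot x^{t-1}\in\mathbb{C}^m$ has components $(\mathcal{A}\cdot x^{t-1})_i=\sum_{i_2,\ldots,i_t\in[n]}a_{ii_2\cdots i_t}x_{i_2}\cdots x_{i_t}$. For a vector $x$, $x^{[r]}=(x_1^r,\ldots,x_n^r)^{\mathrm T}$ (componentwise power; for $r=1/s$ this is the componentwise $s$-th root, no branch being specified in the paper). For $r\le m$, $l\le n$, the subtensor of $\mathcal{A}=(a_{i_1\cdots i_t})\in\mathbb{C}_t^{m,n}$ in $\mathbb{C}_t^{r,l}$ is $\widetilde{\mathcal{A}}=(a_{i_1\cdots i_t})$ with $i_1\in[r]$, $i_2,\ldots,i_t\in[l]$.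 Likewise the subtensor $\widetilde{\mathcal{G}}\in\mathbb{C}_k^{l,r}$ of $\mathcal{G}=(g_{i_1\cdots i_k})\in\mathbb{C}_k^{n,m}$ consists of the entries with $i_1\in[l]$, $i_2,\ldots,i_k\in[r]$. General tensor product: for $\mathcal{A}\in\mathbb{C}_t^{m,n}$, $\mathcal{B}\in\mathbb{C}_k^{n,m}$, $\mathcal{A}\mathcal{B}\in\mathbb{C}_{(t-1)(k-1)+1}^{m,m}$ has entries $(\mathcal{A}\mathcal{B})_{i\alpha_1\cdots\alpha_{t-1}}=\sum_{i_2,\ldots,i_t\in[n]}a_{ii_2\cdots i_t}b_{i_2\alpha_1}\cdots b_{i_t\alpha_{t-1}}$, $i\in[m]$, $\alpha_1,\ldots,\alpha_{t-1}\in[m]^{k-1}$. $\mathcal{X}\in\mathbb{C}_k^{n,m}$ is an order $k$ $\{1\}$ inverse of $\mathcal{A}\in\mathbb{C}_t^{m,n}$ if $\mathcal{A}\mathcal{X}\cdot[(\mathcal{A}\cdot y^{t-1})^{[\frac1s]}]^s=\mathcal{A}\cdot y^{t-1}$ for all $y\in\mathbb{C}^n$, where $s=(t-1)(k-1)$. $\mathcal{A}\{1\}_k$ denotes the set of all order $k$ $\{1\}$ inverses of $\mathcal{A}$. *)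

theory Defs
  imports Complex_Main "HOL-Library.FuncSet"
begin

text \<open>
  A tensor is a function on index lists; indices start at 1. Tensors and vectors are extensional
  functions on their index sets, so that equality means equality of all entries.
\<close>

definition multi_index :: "nat \<Rightarrow> nat \<Rightarrow> nat list set" where
  "multi_index q n = {is. length is = q \<and> set is \<subseteq> {1..n}}"

definition tensor_index :: "nat \<Rightarrow> nat \<Rightarrow> nat \<Rightarrow> nat list set" where
  "tensor_index t m n = {i # is | i is. i \<in> {1..m} \<and> is \<in> multi_index (t - 1) n}"

definition cvec :: "nat \<Rightarrow> (nat \<Rightarrow> complex) set" where
  "cvec n = {1..n} \<rightarrow>\<^sub>E UNIV"

definition tensors :: "nat \<Rightarrow> nat \<Rightarrow> nat \<Rightarrow> (nat list \<Rightarrow> complex) set" where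
  "tensors t m n = tensor_index t m n \<rightarrow>\<^sub>E UNIV"

definition subtensor :: "nat \<Rightarrow> nat \<Rightarrow> nat \<Rightarrow> (nat list \<Rightarrow> complex) \<Rightarrow> (nat list \<Rightarrow> complex)" where
  "subtensor t r l A = restrict A (tensor_index t r l)"

text \<open>\<open>tensor_apply t m n A x\<close> is $A \cdot x^{t-1}$.\<close>

definition tensor_apply ::
  "nat \<Rightarrow> nat \<Rightarrow> nat \<Rightarrow> (nat list \<Rightarrow> complex) \<Rightarrow> (nat \<Rightarrow> complex) \<Rightarrow> (nat \<Rightarrow> complex)" where
  "tensor_apply t m n A x =
     (\<lambda>i\<in>{1..m}. \<Sum>is\<in>multi_index (t - 1) n. A (i # is) * (\<Prod>j<t - 1. x (is ! j)))"

text \<open>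
  The general product of \<open>A\<close> (order \<open>t\<close>, dimension m x n x ... x n) and \<open>B\<close> (order \<open>k\<close>,
  dimension n x m x ... x m). An index of the product is the flattened list
  $i\,\alpha_1 \cdots \alpha_{t-1}$, whose blocks $\alpha_j$ have length \<open>k - 1\<close>;
  \<open>block k j \<alpha>\<close> extracts $\alpha_{j+1}$.
\<close>

definition block :: "nat \<Rightarrow> nat \<Rightarrow> nat list \<Rightarrow> nat list" where
  "block k j \<alpha> = take (k - 1) (drop (j * (k - 1)) \<alpha>)"

definition tensor_prod ::
  "nat \<Rightarrow> nat \<Rightarrow> nat \<Rightarrow> nat \<Rightarrow> (nat list \<Rightarrow> complex) \<Rightarrow> (nat list \<Rightarrow> complex) \<Rightarrow> (nat list \<Rightarrow> complex)" where
  "tensor_prod t k m n A B =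
     (\<lambda>p\<in>tensor_index ((t - 1) * (k - 1) + 1) m m.
        \<Sum>is\<in>multi_index (t - 1) n. A (hd p # is) * (\<Prod>j<t - 1. B (is ! j # block k j (tl p))))"

text \<open>
  The componentwise power $x^{[1/s]}$ needs a choice of complex \<open>s\<close>-th roots, here an arbitrary
  (not necessarily continuous) branch \<open>\<rho> i\<close> for every component \<open>i\<close>. A constant family
  uses the same branch in every component, for instance the principal one.
\<close>

definition root_branches :: "nat \<Rightarrow> (nat \<Rightarrow> complex \<Rightarrow> complex) \<Rightarrow> bool" where
  "root_branches s \<rho> \<longleftrightarrow> (\<forall>i w. \<rho> i w ^ s = w)"

lemma root_branches_principal:
  assumes "s \<ge> 1"
  shows "root_branches s (\<lambda>i w. rcis (root s (cmod w)) (Arg w / real s))"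
  using assms by (simp add: root_branches_def DeMoivre2 rcis_cmod_Arg)

definition vec_root :: "(nat \<Rightarrow> complex \<Rightarrow> complex) \<Rightarrow> nat \<Rightarrow> (nat \<Rightarrow> complex) \<Rightarrow> (nat \<Rightarrow> complex)" where
  "vec_root \<rho> m x = (\<lambda>i\<in>{1..m}. \<rho> i (x i))"

text \<open>
  The order \<open>k\<close> {1} inverses of an order \<open>t\<close> tensor \<open>A\<close> of dimension m x n x ... x n, with \<open>\<rho>\<close>
  giving the \<open>s\<close>-th roots for $s = (t-1)(k-1)$.
\<close>

definition one_inverses ::
  "(nat \<Rightarrow> complex \<Rightarrow> complex) \<Rightarrow> nat \<Rightarrow> nat \<Rightarrow> nat \<Rightarrow> nat \<Rightarrow> (nat list \<Rightarrow> complex) \<Rightarrow> (nat list \<Rightarrow> complex) set" where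
  "one_inverses \<rho> t k m n A =
     {X \<in> tensors k n m. \<forall>y\<in>cvec n.
        tensor_apply ((t - 1) * (k - 1) + 1) m m (tensor_prod t k m n A X)
          (vec_root \<rho> m (tensor_apply t m n A y))
        = tensor_apply t m n A y}"

end

theory Submission
  imports Defs
begin

text \<open>
  The vector $w = \mathcal{A}\cdot y^{t-1}$ vanishes outside $[r]$ and depends only on the first
  $l$ entries of $y$. As $s \ge 1$, every \<open>s\<close>-th root of 0 is 0, so $w^{[1/s]}$ vanishes outside $[r]$
  too. Hence $\mathcal{A}\mathcal{G}\cdot[w^{[1/s]}]^s$ involves only those entries of $\mathcal{A}\mathcal{G}$
  whose trailing indices lie in $[r]$, and these are built from the two subtensors alone. The defining
  equation for $\mathcal{A}$ and $\mathcal{G}$ at $y$ is therefore the one for the subtensors at the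
  truncation of $y$, together with $0 = 0$ in the components beyond $r$.
\<close>

lemma Cons_in_tensor_index_iff [simp]:
  "i # is \<in> tensor_index t m n \<longleftrightarrow> i \<in> {1..m} \<and> is \<in> multi_index (t - 1) n"
  by (auto simp: tensor_index_def)

lemma finite_multi_index [simp]: "finite (multi_index q n)"
  using finite_lists_length_eq[of "{1..n}" q] by (simp add: multi_index_def conj_commute)

lemma multi_index_mono: "l \<le> n \<Longrightarrow> multi_index q l \<subseteq> multi_index q n"
  by (fastforce simp: multi_index_def)

lemma multi_index_nth:
  assumes "is \<in> multi_index q n" "j < q"
  shows "is ! j \<in> {1..n}"
  using assms nth_mem by (fastforce simp: multi_index_def)

lemma block_in_multi_index:
  assumes "\<alpha> \<in> multi_index (q * (k - 1)) n" "j < q"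
  shows "block k j \<alpha> \<in> multi_index (k - 1) n"
proof -
  \<comment> \<open>The first \<open>Suc j\<close> blocks fit into \<alpha>, so after dropping
    \<open>j\<close> of them at least \<open>k - 1\<close> entries remain and \<open>take\<close> is
    not cut short.\<close>
  have "Suc j * (k - 1) \<le> q * (k - 1)"
    using assms(2) by (intro mult_le_mono1) simp
  then have "length (block k j \<alpha>) = k - 1"
    using assms(1) by (simp add: block_def multi_index_def)
  moreover have "set (block k j \<alpha>) \<subseteq> {1..n}"
    using assms(1) set_take_subset set_drop_subset by (fastforce simp: block_def multi_index_def)
  ultimately show ?thesis
    by (simp add: multi_index_def)
qed

lemma sum_multi_index_restrict:
  fixes f :: "nat list \<Rightarrow> complex"
  assumes "l \<le> n" "\<And>is. is \<in> multi_index q n - multi_index q l \<Longrightarrow> f is = 0"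
  shows "sum f (multi_index q n) = sum f (multi_index q l)"
  using assms by (intro sum.mono_neutral_right multi_index_mono ballI) auto

text \<open>An index list that leaves \<open>{1..r}\<close> has some entry in
  \<open>{1..m} - {1..r}\<close>, and this entry contributes a zero factor.\<close>

lemma prod_nth_eq_0:
  fixes v :: "nat \<Rightarrow> complex"
  assumes "is \<in> multi_index q m - multi_index q r" "\<And>i. i \<in> {1..m} - {1..r} \<Longrightarrow> v i = 0"
  shows "(\<Prod>j<q. v (is ! j)) = 0"
proof -
  obtain i where i: "i \<in> set is" "i \<notin> {1..r}" "i \<in> {1..m}"
    using assms(1) unfolding multi_index_def by blast
  then obtain j where "j < q" "is ! j = i"
    using assms(1) by (auto simp: multi_index_def in_set_conv_nth)
  moreover have "v i = 0"
    using i assms(2) by blast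
  ultimately show ?thesis
    by (intro prod_zero) auto
qed

context
  fixes t m n r l :: nat and A :: "nat list \<Rightarrow> complex"
  assumes rm: "r \<le> m" and ln: "l \<le> n"
    and A0: "\<And>p. p \<in> tensor_index t m n - tensor_index t r l \<Longrightarrow> A p = 0"
begin

text \<open>Summands with a trailing index beyond \<open>l\<close> carry a zero entry of
  \<open>A\<close>; the remaining ones read \<open>y\<close> only on \<open>{1..l}\<close>.\<close>

lemma tensor_apply_subtensor:
  assumes "i \<in> {1..r}"
  shows "tensor_apply t m n A y i
    = tensor_apply t r l (subtensor t r l A) (restrict y {1..l}) i"
proof -
  have "(\<Sum>is\<in>multi_index (t - 1) n. A (i # is) * (\<Prod>j<t - 1. y (is ! j)))
      = (\<Sum>is\<in>multi_index (t - 1) l. A (i # is) * (\<Prod>j<t - 1. y (is ! j)))"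
    using assms rm by (intro sum_multi_index_restrict ln) (auto simp: A0)
  also have "\<dots> = (\<Sum>is\<in>multi_index (t - 1) l.
      subtensor t r l A (i # is) * (\<Prod>j<t - 1. restrict y {1..l} (is ! j)))"
    using assms by (intro sum.cong arg_cong2[where f = "(*)"] prod.cong)
      (use multi_index_nth in \<open>auto simp: subtensor_def\<close>)
  finally show ?thesis
    using assms rm by (simp add: tensor_apply_def)
qed

lemma tensor_apply_eq_0:
  assumes "i \<in> {1..m} - {1..r}"
  shows "tensor_apply t m n A y i = 0"
  using assms by (auto simp: tensor_apply_def A0 intro!: sum.neutral)

text \<open>The zeros of \<open>A\<close> confine the contracted indices to \<open>{1..l}\<close>,
  and these are the leading indices of \<open>X\<close>. The trailing indices of \<open>X\<close>
  are blocks of \<alpha>, so taking \<alpha> over \<open>{1..r}\<close> keeps every entry of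
  \<open>X\<close> that is read inside its subtensor.\<close>

lemma tensor_prod_subtensor:
  assumes "i \<in> {1..r}" "\<alpha> \<in> multi_index ((t - 1) * (k - 1)) r"
  shows "tensor_prod t k m n A X (i # \<alpha>)
    = tensor_prod t k r l (subtensor t r l A) (subtensor k l r X) (i # \<alpha>)"
proof -
  have "(\<Sum>is\<in>multi_index (t - 1) n. A (i # is) * (\<Prod>j<t - 1. X (is ! j # block k j \<alpha>)))
      = (\<Sum>is\<in>multi_index (t - 1) l. A (i # is) * (\<Prod>j<t - 1. X (is ! j # block k j \<alpha>)))"
    using assms rm by (intro sum_multi_index_restrict ln) (auto simp: A0)
  also have "\<dots> = (\<Sum>is\<in>multi_index (t - 1) l.
      subtensor t r l A (i # is) * (\<Prod>j<t - 1. subtensor k l r X (is ! j # block k j \<alpha>)))"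
    using assms by (intro sum.cong arg_cong2[where f = "(*)"] prod.cong)
      (use multi_index_nth block_in_multi_index in \<open>auto simp: subtensor_def\<close>)
  finally show ?thesis
    using assms rm multi_index_mono[OF rm] by (auto simp: tensor_prod_def)
qed

lemma tensor_prod_eq_0:
  assumes "i \<in> {1..m} - {1..r}" "\<alpha> \<in> multi_index ((t - 1) * (k - 1)) m"
  shows "tensor_prod t k m n A X (i # \<alpha>) = 0"
  using assms by (auto simp: tensor_prod_def A0 intro!: sum.neutral)

text \<open>The zeros of \<open>v\<close> remove exactly those \<alpha> that leave
  \<open>{1..r}\<close>, where entries of \<open>X\<close> outside its subtensor could enter the
  product.\<close>

lemma tensor_apply_prod_subtensor:
  assumes "i \<in> {1..r}" "\<And>i. i \<in> {1..r} \<Longrightarrow> v i = v' i"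
    and "\<And>i. i \<in> {1..m} - {1..r} \<Longrightarrow> v i = 0"
  shows "tensor_apply ((t - 1) * (k - 1) + 1) m m (tensor_prod t k m n A X) v i
    = tensor_apply ((t - 1) * (k - 1) + 1) r r
        (tensor_prod t k r l (subtensor t r l A) (subtensor k l r X)) v' i"
proof -
  define s where "s = (t - 1) * (k - 1)"
  have "(\<Sum>\<alpha>\<in>multi_index s m. tensor_prod t k m n A X (i # \<alpha>) * (\<Prod>j<s. v (\<alpha> ! j)))
      = (\<Sum>\<alpha>\<in>multi_index s r. tensor_prod t k m n A X (i # \<alpha>) * (\<Prod>j<s. v (\<alpha> ! j)))"
    using prod_nth_eq_0[of _ s m r v] assms(3) by (intro sum_multi_index_restrict rm) simp
  also have "\<dots> = (\<Sum>\<alpha>\<in>multi_index s r.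
      tensor_prod t k r l (subtensor t r l A) (subtensor k l r X) (i # \<alpha>) * (\<Prod>j<s. v' (\<alpha> ! j)))"
    using assms(1) by (intro sum.cong arg_cong2[where f = "(*)"] prod.cong)
      (use multi_index_nth assms(2) in \<open>auto simp: s_def tensor_prod_subtensor\<close>)
  finally show ?thesis
    using assms(1) rm by (simp add: tensor_apply_def s_def)
qed

lemma tensor_apply_prod_eq_0:
  assumes "i \<in> {1..m} - {1..r}"
  shows "tensor_apply ((t - 1) * (k - 1) + 1) m m (tensor_prod t k m n A X) v i = 0"
  using assms by (auto simp: tensor_apply_def tensor_prod_eq_0 intro!: sum.neutral)

text \<open>Stated for a single \<open>y\<close>, so that the change of the quantifier from
  \<open>cvec n\<close> to \<open>cvec l\<close> can be made separately.\<close>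

lemma one_inverse_equation_subtensor:
  assumes "(t - 1) * (k - 1) > 0" "root_branches ((t - 1) * (k - 1)) \<rho>"
  shows "tensor_apply ((t - 1) * (k - 1) + 1) m m (tensor_prod t k m n A X)
        (vec_root \<rho> m (tensor_apply t m n A y)) = tensor_apply t m n A y
    \<longleftrightarrow> tensor_apply ((t - 1) * (k - 1) + 1) r r
        (tensor_prod t k r l (subtensor t r l A) (subtensor k l r X))
        (vec_root \<rho> r (tensor_apply t r l (subtensor t r l A) (restrict y {1..l})))
      = tensor_apply t r l (subtensor t r l A) (restrict y {1..l})"
    (is "?F = ?w \<longleftrightarrow> ?F' = ?w'")
proof -
  have root_0: "\<rho> i 0 = 0" for i
    using assms by (metis root_branches_def power_eq_0_iff)
  have w: "?w i = ?w' i" if "i \<in> {1..r}" for i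
    using that by (rule tensor_apply_subtensor)
  have F: "?F i = ?F' i" if "i \<in> {1..r}" for i
    using that rm
    by (intro tensor_apply_prod_subtensor) (auto simp: vec_root_def w tensor_apply_eq_0 root_0)
  \<comment> \<open>Both sides are \<open>undefined\<close> off \<open>{1..m}\<close>, so equality
    of functions reduces to these components.\<close>
  have "?F = ?w \<longleftrightarrow> (\<forall>i\<in>{1..m}. ?F i = ?w i)"
    by (auto simp: fun_eq_iff tensor_apply_def)
  also have "\<dots> \<longleftrightarrow> (\<forall>i\<in>{1..r}. ?F i = ?w i)"
  proof (intro iffI ballI)
    fix i assume "\<forall>i\<in>{1..r}. ?F i = ?w i" "i \<in> {1..m}"
    then show "?F i = ?w i"
      using tensor_apply_prod_eq_0[of i] tensor_apply_eq_0[of i]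
      by (cases "i \<in> {1..r}") (metis, metis DiffI)
  qed (use rm in auto)
  also have "\<dots> \<longleftrightarrow> (\<forall>i\<in>{1..r}. ?F' i = ?w' i)"
    using w F by simp
  also have "\<dots> \<longleftrightarrow> ?F' = ?w'"
    by (auto simp: fun_eq_iff tensor_apply_def)
  finally show ?thesis .
qed

end

text \<open>Truncation is onto, so a condition on all truncations of vectors in
  \<open>cvec n\<close> is a condition on all of \<open>cvec l\<close>.\<close>

lemma restrict_cvec_image:
  assumes "l \<le> n"
  shows "(\<lambda>y. restrict y {1..l}) ` cvec n = cvec l"
proof (intro equalityI subsetI)
  fix z assume z: "z \<in> cvec l"
  \<comment> \<open>The preimage of \<open>z\<close> is \<open>z\<close> itself viewed in
    \<open>cvec n\<close>: its components beyond \<open>l\<close> have the value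
    \<open>undefined\<close>, which truncation discards.\<close>
  have "restrict (restrict z {1..n}) {1..l} = restrict z {1..l}"
    using assms by (auto simp: restrict_def fun_eq_iff)
  also have "\<dots> = z"
    using z by (simp add: cvec_def PiE_restrict)
  finally show "z \<in> (\<lambda>y. restrict y {1..l}) ` cvec n"
    by (intro image_eqI[where x = "restrict z {1..n}"]) (simp_all add: cvec_def)
qed (auto simp: cvec_def)

theorem theorem2p4:
  fixes t k m n r l :: nat
    and A :: "nat list \<Rightarrow> complex"
    and \<rho> :: "nat \<Rightarrow> complex \<Rightarrow> complex"
  assumes "t \<ge> 2" and "k \<ge> 2"
    and "r \<le> m" and "l \<le> n"
    and "A \<in> tensors t m n"
    and "\<forall>p \<in> tensor_index t m n - tensor_index t r l. A p = 0"
    and "root_branches ((t - 1) * (k - 1)) \<rho>"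
  shows "one_inverses \<rho> t k m n A =
    {G \<in> tensors k n m. subtensor k l r G \<in> one_inverses \<rho> t k r l (subtensor t r l A)}"
proof -
  define P where "P G y \<longleftrightarrow> tensor_apply ((t - 1) * (k - 1) + 1) r r
        (tensor_prod t k r l (subtensor t r l A) (subtensor k l r G))
        (vec_root \<rho> r (tensor_apply t r l (subtensor t r l A) y))
      = tensor_apply t r l (subtensor t r l A) y" for G y
  have "one_inverses \<rho> t k m n A
      = {G \<in> tensors k n m. \<forall>y\<in>cvec n. P G (restrict y {1..l})}"
    unfolding one_inverses_def P_def using assms
    by (subst one_inverse_equation_subtensor[of r m l n]) auto
  also have "\<dots> = {G \<in> tensors k n m. \<forall>y\<in>cvec l. P G y}"
    by (simp flip: restrict_cvec_image[OF \<open>l \<le> n\<close>])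
  \<comment> \<open>A restriction is extensional, so \<open>subtensor k l r G\<close> always lies in
    \<open>tensors k l r\<close>, and membership in the set of inverses is just the equation
    \<open>P\<close>.\<close>
  also have "\<dots> = {G \<in> tensors k n m. subtensor k l r G \<in> one_inverses \<rho> t k r l (subtensor t r l A)}"
    by (auto simp: one_inverses_def P_def subtensor_def tensors_def)
  finally show ?thesis .
qed

end
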